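(* Let $P \subseteq \mathbb{R}^2$ have a rightmost column, i.e. the set of $x$-coordinates of points of $P$ has a maximum $x_0$. Let $c > 0$, let $(x_0, y_0) \in P$ be a point in the rightmost column, and let $P' = P \cup \{(x_0 + u, y_0) : 0 \le u \le c\}$ be obtained from $P$ by adding a horizontal segment of length $c$ with its left endpoint at $(x_0, y_0)$. Then $\operatorname{opx}(n, P') \le \operatorname{opx}(n, P) + cn$ for all real $n > 0$.
   Context: Containment for subsets of the plane: for $P, S \subseteq \mathbb{R}^2$, let $X_P, Y_P$ be the sets of $x$-coordinates and $y$-coordinates of points of $P$, and $X_S, Y_S$ likewise for $S$. $S$ contains $P$ if there exist functions $f_X: X_P \to X_S$ and $f_Y: Y_P \to Y_S$ such that (1) $\frac{f_X(x_0)-f_X(x_1)}{x_0-x_1} \ge 1$ for all $x_0 > x_1$ in $X_P$; (2) $\frac{f_Y(y_0)-f_Y(y_1)}{y_0-y_1} \ge 1$ for all $y_0 > y_1$ in $Y_P$; (3) $(f_X(x), f_Y(y)) \in S$ for all $(x,y) \in P$. Otherwise $S$ is $P$-free. For real $n > 0$, $\operatorname{opx}(n,P)$ is the supremum of the Lebesgue measure $\mu_2(S)$ over all open (in $\mathbb{R}^2$) $P$-free subsets $S \subseteq [0,n]^2$. The columns of $P$ are its maximal subsets with the same $x$-coordinate. *)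

theory Defs
  imports "HOL-Analysis.Analysis"
begin

text \<open>
  The coordinate maps are functions on the coordinate sets \<^term>\<open>fst ` P\<close> and \<^term>\<open>snd ` P\<close>.
  They are represented by total functions, whose values off these sets play no role.
\<close>

definition expanding_on :: "real set \<Rightarrow> (real \<Rightarrow> real) \<Rightarrow> bool" where
  "expanding_on A f \<longleftrightarrow> (\<forall>s\<in>A. \<forall>t\<in>A. s > t \<longrightarrow> (f s - f t) / (s - t) \<ge> 1)"

definition contains :: "(real \<times> real) set \<Rightarrow> (real \<times> real) set \<Rightarrow> bool" where
  "contains S P \<longleftrightarrow>
     (\<exists>fX \<in> fst ` P \<rightarrow> fst ` S. \<exists>fY \<in> snd ` P \<rightarrow> snd ` S.
        expanding_on (fst ` P) fX \<and> expanding_on (snd ` P) fY \<and>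
        (\<forall>(x, y)\<in>P. (fX x, fY y) \<in> S))"

abbreviation pattern_free :: "(real \<times> real) set \<Rightarrow> (real \<times> real) set \<Rightarrow> bool" where
  "pattern_free P S \<equiv> \<not> contains S P"

text \<open>
  The supremum is taken in \<^typ>\<open>ennreal\<close>, so it always exists. It is at most \<open>n\<^sup>2\<close>, and it is
  \<open>0\<close> in the degenerate case \<open>P = {}\<close>, where no set is \<open>P\<close>-free.
\<close>

definition opx :: "real \<Rightarrow> (real \<times> real) set \<Rightarrow> ennreal" where
  "opx n P = (SUP S \<in> {S. open S \<and> S \<subseteq> {0..n} \<times> {0..n} \<and> pattern_free P S}. emeasure lborel S)"

end

theory Submission
  imports Defs
begin

text \<open>
  Let \<open>S\<close> be open and \<open>P'\<close>-free, and let \<open>T\<close> consist of the points of \<open>S\<close> to the right of which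
  their row of \<open>S\<close> has measure more than \<open>c\<close>. A copy of \<open>P\<close> in \<open>T\<close> would extend to a copy of \<open>P'\<close>
  in \<open>S\<close>: to the right of the image of \<open>(x0, y0)\<close> there is a compact part \<open>K\<close> of the row with
  measure more than \<open>c\<close>, and any right inverse of the 1-Lipschitz function
  \<open>t \<mapsto> |K \<inter> (-\<infinity>, t]|\<close> maps \<open>[0, c]\<close> expandingly into \<open>K\<close>. Hence \<open>T\<close> is \<open>P\<close>-free, and since
  every row loses measure at most \<open>c\<close>, Fubini's theorem shows that \<open>S - T\<close> has measure at most
  \<open>c * n\<close>.
\<close>

lemma expanding_on_iff:
  "expanding_on A f \<longleftrightarrow> (\<forall>s\<in>A. \<forall>t\<in>A. t < s \<longrightarrow> s - t \<le> f s - f t)"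
  by (auto simp: expanding_on_def le_divide_eq)

text \<open>Every coordinate of \<open>P\<close> belongs to a point of \<open>P\<close>, so the
  incidence condition already places the values of both maps in the coordinate sets of
  \<open>S\<close>.\<close>

lemma containsI:
  assumes "expanding_on (fst ` P) f" "expanding_on (snd ` P) h"
    and S: "\<And>x y. (x, y) \<in> P \<Longrightarrow> (f x, h y) \<in> S"
  shows "contains S P"
proof -
  have "f \<in> fst ` P \<rightarrow> fst ` S" "h \<in> snd ` P \<rightarrow> snd ` S"
    using S by force+
  then show ?thesis
    using assms unfolding contains_def by blast
qed

text \<open>An open set is an increasing union of compact sets, which stay compact after
  intersection with \<open>F\<close>. By continuity from below, one of them already has measure
  above \<open>b\<close>.\<close>

lemma locally_closed_inner_compact:
  fixes A F :: "'a::euclidean_space set"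
  assumes "open A" "closed F" "b < emeasure lborel (A \<inter> F)"
  obtains K where "compact K" "K \<subseteq> A \<inter> F" "b < emeasure lborel K"
proof -
  obtain C where C: "\<And>n. compact (C n)" "\<And>n. C n \<subseteq> A"
      "\<And>n. C n \<subseteq> interior (C (Suc n))" "\<Union>(range C) = A"
    by (rule open_Union_compact_subsets[OF \<open>open A\<close>], rule that)
  have "C n \<subseteq> C (Suc n)" for n
    using C(3) interior_subset by (rule subset_trans)
  then have "incseq (\<lambda>n. C n \<inter> F)"
    by (intro incseq_SucI) auto
  then have "(SUP n. emeasure lborel (C n \<inter> F)) = emeasure lborel (\<Union>n. C n \<inter> F)"
    using C \<open>closed F\<close>
    by (intro SUP_emeasure_incseq) (auto intro!: borel_compact compact_Int_closed)
  also have "(\<Union>n. C n \<inter> F) = A \<inter> F"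
    using C(4) by auto
  finally have "b < (SUP n. emeasure lborel (C n \<inter> F))"
    using assms(3) by simp
  then obtain n where n: "b < emeasure lborel (C n \<inter> F)"
    unfolding less_SUP_iff by blast
  show thesis
  proof (rule that)
    show "compact (C n \<inter> F)" using C(1) \<open>closed F\<close> by (rule compact_Int_closed)
    show "C n \<inter> F \<subseteq> A \<inter> F" using C(2)[of n] by blast
  qed (rule n)
qed

text \<open>Lower semicontinuity of the slice measure: a compact part of the slice at
  \<open>p\<close> with measure above \<open>b\<close> lies, by the tube lemma, in all slices at
  nearby points. This will make \<open>T\<close> open, as \<open>opx\<close> requires.\<close>

lemma open_slice_emeasure_greater:
  fixes W :: "('a::topological_space \<times> 'b::euclidean_space) set"
  assumes "open W"
  shows "open {p. b < emeasure lborel (Pair p -` W)}"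
proof (rule Topological_Spaces.openI, clarify)
  fix p assume b: "b < emeasure lborel (Pair p -` W)"
  have slice: "open (Pair q -` W)" for q
    using \<open>open W\<close> by (intro open_vimage continuous_intros)
  obtain K where K: "compact K" "K \<subseteq> Pair p -` W" "b < emeasure lborel K"
    using locally_closed_inner_compact[of "Pair p -` W" UNIV b] slice b by auto
  then have "{p} \<times> K \<subseteq> W" by auto
  with K obtain X where X: "p \<in> X" "open X" "X \<times> K \<subseteq> W"
    using Elementary_Topology.tube_lemma[of K W p] \<open>open W\<close> by blast
  have "X \<subseteq> {q. b < emeasure lborel (Pair q -` W)}"
  proof (intro subsetI CollectI)
    fix q assume "q \<in> X"
    then have "emeasure lborel K \<le> emeasure lborel (Pair q -` W)"
      using X slice[of q] by (intro emeasure_mono) auto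
    with K(3) show "b < emeasure lborel (Pair q -` W)" by (rule less_le_trans)
  qed
  with X show "\<exists>X. open X \<and> p \<in> X \<and> X \<subseteq> {q. b < emeasure lborel (Pair q -` W)}"
    by blast
qed

text \<open>A right inverse of a nondecreasing 1-Lipschitz function is expanding. Here the function
  is the mass of \<open>K\<close> up to \<open>t\<close>; as \<open>x\<close> is the least point of
  \<open>K\<close>, it vanishes at \<open>x\<close>.\<close>

lemma expanding_into_compact:
  fixes K :: "real set"
  assumes "compact K" "x \<in> K" "K \<subseteq> {x..}" "ennreal c < emeasure lborel K" "0 \<le> c"
  obtains g where "g 0 = x" "g ` {0..c} \<subseteq> K" "expanding_on {0..c} g"
proof -
  define m where "m t = measure lborel (K \<inter> {..t})" for t
  have KL: "K \<in> fmeasurable lborel"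
    using \<open>compact K\<close> by (intro fmeasurable_compact)
  then have KI: "K \<inter> A \<in> fmeasurable lborel" if "A \<in> sets borel" for A
    using that by (intro fmeasurable_Int_fmeasurable) auto
  have lip: "0 \<le> m t - m s \<and> m t - m s \<le> t - s" if "s \<le> t" for s t
  proof -
    have "K \<inter> {..t} = (K \<inter> {..s}) \<union> (K \<inter> {s<..t})"
      using that by auto
    then have "m t = m s + measure lborel (K \<inter> {s<..t})"
      unfolding m_def using KI by (simp only:) (rule measure_Un_AE, auto)
    moreover have "measure lborel (K \<inter> {s<..t}) \<le> measure lborel {s<..t}"
      by (rule measure_mono_fmeasurable) (use KI[of "{s<..t}"] that in \<open>auto intro: fmeasurableI\<close>)
    ultimately show ?thesis using that by simp
  qed
  have cont: "continuous_on UNIV m"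
  proof (rule lipschitz_on_continuous_on)
    show "1-lipschitz_on UNIV m"
    proof (rule lipschitz_onI)
      show "dist (m s) (m t) \<le> 1 * dist s t" for s t
        using lip[of s t] lip[of t s] by (cases "s \<le> t") (auto simp: dist_real_def)
    qed simp
  qed
  have mx: "m x = 0"
  proof -
    have "K \<inter> {..x} = {x}" using assms by auto
    then show ?thesis by (simp add: m_def)
  qed
  obtain B where B: "\<And>t. t \<in> K \<Longrightarrow> t \<le> B"
    using \<open>compact K\<close> by (meson bdd_above_def bounded_imp_bdd_above compact_imp_bounded)
  have "K \<inter> {..B} = K" using B by auto
  then have mB: "c < m B"
    using assms(4,5) KL by (simp add: m_def emeasure_eq_measure2 ennreal_less_iff)
  have "\<exists>t\<in>K. m t = u" if u: "0 \<le> u" "u \<le> c" for u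
  proof -
    obtain t where t: "x \<le> t" "m t = u"
      using IVT'[of m x u B] mx mB u B[OF \<open>x \<in> K\<close>] continuous_on_subset[OF cont] by auto
    \<comment> \<open>The intermediate value \<open>t\<close> may lie in a gap of \<open>K\<close>.
      The last point \<open>s\<close> of \<open>K\<close> up to \<open>t\<close> cuts off the same
      part of \<open>K\<close>, so \<open>m\<close> takes the same value there.\<close>
    have "compact (K \<inter> {..t})" "K \<inter> {..t} \<noteq> {}"
      using \<open>compact K\<close> \<open>x \<in> K\<close> t by (auto intro: compact_Int_closed)
    then obtain s where s: "s \<in> K \<inter> {..t}" "\<And>r. r \<in> K \<inter> {..t} \<Longrightarrow> r \<le> s"
      using compact_attains_sup by metis
    then have "K \<inter> {..s} = K \<inter> {..t}" by force
    then have "m s = u" using t by (simp add: m_def)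
    with s show ?thesis by blast
  qed
  then obtain h where h: "\<And>u. 0 \<le> u \<Longrightarrow> u \<le> c \<Longrightarrow> h u \<in> K \<and> m (h u) = u"
    by metis
  \<comment> \<open>\<open>h 0\<close> may be another point of \<open>K\<close> with no mass before
    it, so the value at \<open>0\<close> is reset to \<open>x\<close>.\<close>
  define g where "g = h(0 := x)"
  have g: "g u \<in> K" "m (g u) = u" if "0 \<le> u" "u \<le> c" for u
    using h that mx \<open>x \<in> K\<close> by (auto simp: g_def)
  have "expanding_on {0..c} g"
    unfolding expanding_on_iff
  proof clarsimp
    fix s t assume st: "s \<le> c" "0 \<le> t" "t < s"
    \<comment> \<open>If \<open>g t \<le> g s\<close>, the Lipschitz bound is the claim; otherwise
      monotonicity of \<open>m\<close> would give \<open>s \<le> t\<close>.\<close>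
    then show "s - t \<le> g s - g t"
      using g[of s] g[of t] lip[of "g t" "g s"] lip[of "g s" "g t"] by (cases "g t \<le> g s") auto
  qed
  with g show thesis
    by (intro that[of g]) (use g(1) in auto, simp add: g_def)
qed

text \<open>Up to \<open>x0\<close> the map \<open>fX\<close> is kept; beyond it, an expanding map
  runs along the row of \<open>S\<close> through the image of \<open>(x0, y0)\<close>. The two
  pieces agree at \<open>x0\<close>. The segment brings no new y-coordinate, so \<open>fY\<close> is
  unchanged.\<close>

lemma contains_add_segment:
  assumes rightmost: "\<forall>p\<in>P. fst p \<le> x0"
    and point: "(x0, y0) \<in> P"
    and "T \<subseteq> S" "open S" "0 \<le> c"
    and long: "\<And>x y. (x, y) \<in> T \<Longrightarrow> ennreal c < emeasure lborel {t. x < t \<and> (t, y) \<in> S}"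
    and "contains T P"
  shows "contains S (P \<union> {(x0 + u, y0) | u. 0 \<le> u \<and> u \<le> c})" (is "contains S ?P'")
proof -
  from \<open>contains T P\<close> obtain fX fY
    where ex: "expanding_on (fst ` P) fX" and ey: "expanding_on (snd ` P) fY"
      and T: "\<And>x y. (x, y) \<in> P \<Longrightarrow> (fX x, fY y) \<in> T"
    unfolding contains_def by blast
  define x y where "x = fX x0" and "y = fY y0"
  have xy: "(x, y) \<in> T" using T point by (simp add: x_def y_def)
  have op: "open {t. (t, y) \<in> S}"
    using open_vimage[OF \<open>open S\<close>, of "\<lambda>t. (t, y)"] by (simp add: vimage_def continuous_intros)
  define A where "A = {x<..} \<inter> {t. (t, y) \<in> S}"
  with op have "open A" by (simp add: open_Int)
  moreover have "A = {t. x < t \<and> (t, y) \<in> S}" by (auto simp: A_def)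
  with long[OF xy] have "ennreal c < emeasure lborel (A \<inter> UNIV)" by simp
  ultimately obtain K where K: "compact K" "K \<subseteq> A" "ennreal c < emeasure lborel K"
    using locally_closed_inner_compact[OF _ closed_UNIV] by (metis Int_UNIV_right)
  \<comment> \<open>\<open>K\<close> lies strictly to the right of \<open>x\<close>; adding
    \<open>x\<close> supplies the least point at which \<open>g\<close> has to start.\<close>
  have "emeasure lborel K \<le> emeasure lborel (insert x K)"
    using K(1) by (intro emeasure_mono) (auto simp: compact_imp_closed)
  with K(3) have "ennreal c < emeasure lborel (insert x K)" by (rule less_le_trans)
  moreover have "compact (insert x K)" "insert x K \<subseteq> {x..}"
    using K by (auto simp: A_def)
  ultimately obtain g where g: "g 0 = x" "g ` {0..c} \<subseteq> insert x K" "expanding_on {0..c} g"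
    using expanding_into_compact[OF _ insertI1] \<open>0 \<le> c\<close> by metis
  have gS: "(g u, y) \<in> S" if "0 \<le> u" "u \<le> c" for u
  proof -
    have "g u \<in> insert x K" using g(2) that by (meson atLeastAtMost_iff image_subset_iff)
    then show ?thesis using K(2) xy \<open>T \<subseteq> S\<close> by (auto simp: A_def)
  qed
  define f where "f s = (if s \<le> x0 then fX s else g (s - x0))" for s
  have f_right: "f s = g (s - x0)" if "x0 \<le> s" for s
    using that g(1) by (cases "s = x0") (auto simp: f_def x_def)
  have fS: "(f s, fY t) \<in> S" if "(s, t) \<in> ?P'" for s t
    using that
  proof
    assume P: "(s, t) \<in> P"
    with rightmost have "s \<le> x0" by fastforce
    with T[OF P] \<open>T \<subseteq> S\<close> show ?thesis by (auto simp: f_def)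
  qed (use gS f_right in \<open>auto simp: y_def\<close>)
  have left: "s \<in> fst ` P" if "s \<in> fst ` ?P'" "s \<le> x0" for s
    using that point by (force simp: image_iff)
  have right: "s \<le> x0 + c" if "s \<in> fst ` ?P'" for s
    using that rightmost \<open>0 \<le> c\<close> by fastforce
  have x0P: "x0 \<in> fst ` P" using point by force
  have step_left: "s - t \<le> f s - f t"
    if "s \<in> fst ` P" "t \<in> fst ` P" "t \<le> s" "s \<le> x0" for s t
  proof (cases "t = s")
    case False
    with that ex have "s - t \<le> fX s - fX t"
      unfolding expanding_on_iff by (meson less_le)
    with that show ?thesis by (simp add: f_def)
  qed simp
  have step_right: "s - t \<le> f s - f t" if "x0 \<le> t" "t \<le> s" "s \<le> x0 + c" for s t
  proof (cases "t = s")
    case False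
    with that have "s - x0 \<in> {0..c}" "t - x0 \<in> {0..c}" "t - x0 < s - x0" by auto
    with g(3) have "(s - x0) - (t - x0) \<le> g (s - x0) - g (t - x0)"
      unfolding expanding_on_iff by blast
    with that show ?thesis by (simp add: f_right)
  qed simp
  have "expanding_on (fst ` ?P') f"
    unfolding expanding_on_iff
  proof (intro ballI impI)
    fix s t assume s: "s \<in> fst ` ?P'" and t: "t \<in> fst ` ?P'" and "t < s"
    consider "s \<le> x0" | "x0 \<le> t" | "t < x0" "x0 < s" by linarith
    then show "s - t \<le> f s - f t"
    proof cases
      case 1
      with step_left[OF left[OF s] left[OF t]] \<open>t < s\<close> show ?thesis by linarith
    next
      case 2
      with step_right[of t s] right[OF s] \<open>t < s\<close> show ?thesis by linarith
    next
      \<comment> \<open>Across the seam, the bounds from \<open>t\<close> to \<open>x0\<close> and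
        from \<open>x0\<close> to \<open>s\<close> add up.\<close>
      case 3
      with step_left[OF x0P left[OF t]] step_right[of x0 s] right[OF s] show ?thesis by linarith
    qed
  qed
  moreover have "snd ` ?P' = snd ` P"
    using point by force
  with ey have "expanding_on (snd ` ?P') fY" by simp
  ultimately show ?thesis
    using fS by (rule containsI)
qed

text \<open>A compact part of \<open>A \<inter> F\<close> with measure above \<open>b\<close> would
  have a least point \<open>k\<close>. Apart from the null set \<open>{k}\<close> it lies in the
  tail of \<open>A\<close> beyond \<open>k\<close>, whose measure is at most
  \<open>b\<close>.\<close>

lemma emeasure_short_tail_le:
  fixes A :: "real set"
  assumes "open A" "closed F"
    and tail: "\<And>x. x \<in> A \<inter> F \<Longrightarrow> emeasure lborel {t. x < t \<and> t \<in> A} \<le> b"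
  shows "emeasure lborel (A \<inter> F) \<le> b"
proof (rule ccontr)
  assume "\<not> emeasure lborel (A \<inter> F) \<le> b"
  then have "b < emeasure lborel (A \<inter> F)" by simp
  then obtain K where K: "compact K" "K \<subseteq> A \<inter> F" "b < emeasure lborel K"
    using locally_closed_inner_compact assms(1,2) by metis
  then have "K \<noteq> {}" by auto
  then obtain k where k: "k \<in> K" "\<And>t. t \<in> K \<Longrightarrow> k \<le> t"
    using compact_attains_inf[OF K(1)] by blast
  have "{t. k < t \<and> t \<in> A} = {k<..} \<inter> A" by auto
  then have meas: "{t. k < t \<and> t \<in> A} \<in> sets lborel" using \<open>open A\<close> by auto
  have "emeasure lborel K \<le> emeasure lborel ({k} \<union> {t. k < t \<and> t \<in> A})"
  proof (intro emeasure_mono)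
    show "K \<subseteq> {k} \<union> {t. k < t \<and> t \<in> A}"
      using k K(2) by (force simp: less_le)
  qed (use meas in auto)
  also have "\<dots> \<le> emeasure lborel {k} + emeasure lborel {t. k < t \<and> t \<in> A}"
    using meas by (intro emeasure_subadditive) auto
  also have "\<dots> \<le> b"
    using tail[of k] k K(2) by auto
  finally show False using K(3) by simp
qed

theorem lemma2p9:
  fixes P P' :: "(real \<times> real) set" and x0 y0 c n :: real
  assumes rightmost: "\<forall>p\<in>P. fst p \<le> x0"
    and point: "(x0, y0) \<in> P"
    and c: "c > 0"
    and P': "P' = P \<union> {(x0 + u, y0) | u. 0 \<le> u \<and> u \<le> c}"
    and n: "n > 0"
  shows "opx n P' \<le> opx n P + ennreal (c * n)"
  unfolding opx_def[of n P']
proof (rule SUP_least, clarify)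
  fix S assume S: "open S" "S \<subseteq> {0..n} \<times> {0..n}" and free: "pattern_free P' S"
  define L where "L = {p. ennreal c < emeasure lborel {t. fst p < t \<and> (t, snd p) \<in> S}}"
  \<comment> \<open>The slice of this set at \<open>p\<close> is the part of the row of
    \<open>S\<close> to the right of \<open>p\<close>, so semicontinuity of slice measures makes
    \<open>L\<close> open.\<close>
  have "open {(p, t). fst p < t \<and> (t, snd p) \<in> S}"
  proof -
    have "{(p, t). fst p < t \<and> (t, snd p) \<in> S}
        = {z. fst (fst z) < snd z} \<inter> (\<lambda>z. (snd z, snd (fst z))) -` S" by auto
    moreover have "open ((\<lambda>z::(real \<times> real) \<times> real. (snd z, snd (fst z))) -` S)"
      using S(1) by (intro open_vimage continuous_intros)
    ultimately show ?thesis
      by (auto intro!: open_Int open_Collect_less continuous_intros)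
  qed
  from open_slice_emeasure_greater[OF this, of "ennreal c"]
  have L: "open L" by (simp add: L_def vimage_def)
  define T where "T = S \<inter> L"
  have T: "open T" "T \<subseteq> S" using S(1) L by (auto simp: T_def)
  have "pattern_free P T"
    using contains_add_segment[OF rightmost point T(2) S(1), of c] free c
    by (auto simp: P' T_def L_def)
  with T S have T_le: "emeasure lborel T \<le> opx n P"
    unfolding opx_def by (intro SUP_upper) auto
  \<comment> \<open>A row of \<open>S - T\<close> is an open row of \<open>S\<close> cut by a closed
    row of \<open>- L\<close>, and at points of \<open>- L\<close> the tail in \<open>S\<close> has
    measure at most \<open>c\<close>.\<close>
  have row: "emeasure lborel ((\<lambda>x. (x, y)) -` (S - T)) \<le> ennreal c * indicator {0..n} y" for y
  proof (cases "y \<in> {0..n}")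
    case True
    have "open ((\<lambda>x. (x, y)) -` S)" "closed ((\<lambda>x. (x, y)) -` (- L))"
      using S(1) L by (auto intro!: open_vimage closed_vimage continuous_intros)
    then have "emeasure lborel ((\<lambda>x. (x, y)) -` S \<inter> (\<lambda>x. (x, y)) -` (- L)) \<le> ennreal c"
      by (rule emeasure_short_tail_le) (auto simp: L_def)
    moreover have "(\<lambda>x. (x, y)) -` S \<inter> (\<lambda>x. (x, y)) -` (- L) = (\<lambda>x. (x, y)) -` (S - T)"
      by (auto simp: T_def)
    ultimately show ?thesis using True by simp
  next
    case False
    then have "(\<lambda>x. (x, y)) -` (S - T) = {}" using S(2) by auto
    then show ?thesis by simp
  qed
  have meas: "S - T \<in> sets (lborel \<Otimes>\<^sub>M lborel)"
    unfolding lborel_prod using S(1) T(1) by auto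
  \<comment> \<open>The outer integral runs over the second coordinate, so that the inner measures
    are those of rows.\<close>
  have "emeasure lborel (S - T) = (\<integral>\<^sup>+y. emeasure lborel ((\<lambda>x. (x, y)) -` (S - T)) \<partial>lborel)"
    using lborel_pair.emeasure_pair_measure_alt2[OF meas] by (simp add: lborel_prod)
  also have "\<dots> \<le> (\<integral>\<^sup>+y. ennreal c * indicator {0..n} y \<partial>lborel)"
    by (intro nn_integral_mono row)
  also have "\<dots> = ennreal (c * n)"
    using c n by (simp add: nn_integral_cmult_indicator ennreal_mult)
  finally have diff: "emeasure lborel (S - T) \<le> ennreal (c * n)" .
  have "emeasure lborel S = emeasure lborel (T \<union> (S - T))"
    using T(2) by (simp add: Un_absorb1)
  also have "\<dots> \<le> emeasure lborel T + emeasure lborel (S - T)"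
    using S(1) T(1) by (intro emeasure_subadditive) auto
  also have "\<dots> \<le> opx n P + ennreal (c * n)"
    using T_le diff by (rule add_mono)
  finally show "emeasure lborel S \<le> opx n P + ennreal (c * n)" .
qed

end
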